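(* Let $f:\mathbb{R}^n\to\mathbb{R}$ be convex and $L$-smooth with a minimizer $x^*$, $f^*=f(x^* )$, let $x^0\in\mathbb{R}^n$, $R=\|x^0-x^*\|_2$, let $0<\varepsilon<LR^2$, $0\le\beta\le1/2$, and let $\widetilde\nabla f$ satisfy the relative noise condition with parameter $$0\le\alpha\le\frac13\left(\frac{\varepsilon}{12LR^2}\right)^{\beta}.$$ Then the algorithm RE-AGM combined with the regularization technique solves the problem with precision $\varepsilon$: there are a regularization parameter $\mu>0$ and input parameters $L'\ge\mu'>0$, $a\in[0,1/3]$, depending only on $L,R,\alpha,\beta,\varepsilon$, such that RE-AGM with parameters $(L',\mu',x^0,a)$ applied to $f_\mu(\cdot\,|\,x^0)$ with the gradient estimate $\widetilde\nabla f_\mu$ produces a point $x^N$ with $f(x^N)-f^*\le\varepsilon$ for some number of iterations $$N\le150\left(\frac{12LR^2}{\varepsilon}\right)^{1-\beta}\ln\left(\frac{4LR^2}{\varepsilon}\right)+1.$$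
   Context: $\|\cdot\|_2$ is the Euclidean norm; $f$ is differentiable. Convex: $f(x)+\langle\nabla f(x),y-x\rangle\le f(y)$ for all $x,y$. $L$-smooth: $f(y)\le f(x)+\langle\nabla f(x),y-x\rangle+\frac L2\|x-y\|_2^2$ for all $x,y$. Relative noise condition with parameter $\alpha$: $\|\widetilde\nabla f(x)-\nabla f(x)\|_2\le\alpha\|\nabla f(x)\|_2$ for all $x$. Regularization technique: the method is applied to $f_\mu(x\,|\,x^0)=f(x)+\frac\mu2\|x-x^0\|_2^2$, with gradient estimate $\widetilde\nabla f_\mu(x)=\widetilde\nabla f(x)+\mu(x-x^0)$. Algorithm RE-AGM with parameters $(L',\mu',x^0,a)$ and a gradient estimate $\widetilde g:\mathbb{R}^n\to\mathbb{R}^n$ (here $\widetilde g=\widetilde\nabla f_\mu$): put $h=\frac1{4L'}\left(\frac{1-a}{1+a}\right)^{3/2}$, $\widehat L=8\frac{1+a}{(1-a)^3}L'$, $\gamma^*=\min\{\log_{\mu'/(2L')}(3a),\frac12\}$ (with $\log_{\mu'/(2L')}0=+\infty$), $s=\left(1+\frac14\left(\frac{\mu'}{2L'}\right)^{\gamma^*}\right)(1+a)^2+2a^2$, $m=\left(1-\frac14\left(\frac{\mu'}{2L'}\right)^{\gamma^*}\right)(1-a)^2-2a^2$, $q=\frac{\mu'}{2\widehat L}$, and let $\omega=\frac{(m-s)+\sqrt{(s-m)^2+4mq}}{2m}$ be the largest root of $m\omega^2+(s-m)\omega-q=0$. Set $u^0=x^0$ and for $k=0,1,2,\dots$ $$y^k=\frac{\omega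 u^k+x^k}{1+\omega},\qquad u^{k+1}=(1-\omega)u^k+\omega y^k-\frac{2\omega}{\mu'}\widetilde g(y^k),\qquad x^{k+1}=y^k-h\,\widetilde g(y^k).$$ *)

theory Defs
  imports "HOL-Analysis.Analysis"
begin

section \<open>The spaces R^n inside one type\<close>

text \<open>
  The parameters of the method may depend on the constants of the problem but not on the
  dimension. So the dimension has to be quantified inside the statement, below the parameters,
  which rules out \<^typ>\<open>real ^ 'n\<close>. Instead, all the spaces R^n are taken inside the
  inner product space of finitely supported real sequences: \<open>Rn n\<close> consists of the
  sequences that vanish from index n on. (The library's norm on finitely supported functions,
  in \<open>Finite_Function_Topology\<close>, is the 1-norm, hence a separate type.)
\<close>

typedef fseq = "{x :: nat \<Rightarrow> real. finite {i. x i \<noteq> 0}}"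
  morphisms coord Abs_fseq
  by (rule exI[of _ "\<lambda>_. 0"]) simp

setup_lifting type_definition_fseq

lemma finite_coord [simp]: "finite {i. coord x i \<noteq> 0}"
  using coord[of x] by simp

lemma fseq_eqI: "(\<And>i. coord x i = coord y i) \<Longrightarrow> x = y"
  by (simp add: coord_inject[symmetric] fun_eq_iff)

instantiation fseq :: real_vector
begin

lift_definition zero_fseq :: fseq is "\<lambda>_. 0" by simp

lift_definition plus_fseq :: "fseq \<Rightarrow> fseq \<Rightarrow> fseq" is "\<lambda>x y i. x i + y i"
  subgoal for x y
    by (rule finite_subset[of _ "{i. x i \<noteq> 0} \<union> {i. y i \<noteq> 0}"]) auto
  done

lift_definition minus_fseq :: "fseq \<Rightarrow> fseq \<Rightarrow> fseq" is "\<lambda>x y i. x i - y i"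
  subgoal for x y
    by (rule finite_subset[of _ "{i. x i \<noteq> 0} \<union> {i. y i \<noteq> 0}"]) auto
  done

lift_definition uminus_fseq :: "fseq \<Rightarrow> fseq" is "\<lambda>x i. - x i" by simp

lift_definition scaleR_fseq :: "real \<Rightarrow> fseq \<Rightarrow> fseq" is "\<lambda>r x i. r * x i"
  subgoal for r x
    by (rule finite_subset[of _ "{i. x i \<noteq> 0}"]) auto
  done

instance
  by standard (transfer; simp add: fun_eq_iff algebra_simps)+

end

lemmas coord_simps [simp] =
  zero_fseq.rep_eq plus_fseq.rep_eq minus_fseq.rep_eq uminus_fseq.rep_eq scaleR_fseq.rep_eq

instantiation fseq :: real_inner
begin

definition inner_fseq :: "fseq \<Rightarrow> fseq \<Rightarrow> real" where
  "inner_fseq x y = (\<Sum>i | coord x i \<noteq> 0. coord x i * coord y i)"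

definition norm_fseq :: "fseq \<Rightarrow> real" where
  "norm_fseq x = sqrt (inner x x)"

definition dist_fseq :: "fseq \<Rightarrow> fseq \<Rightarrow> real" where
  "dist_fseq x y = norm (x - y)"

definition sgn_fseq :: "fseq \<Rightarrow> fseq" where
  "sgn_fseq x = x /\<^sub>R norm x"

definition uniformity_fseq :: "(fseq \<times> fseq) filter" where
  "uniformity_fseq = (INF e\<in>{0<..}. principal {(x, y). dist x y < e})"

definition open_fseq :: "fseq set \<Rightarrow> bool" where
  "open_fseq U \<longleftrightarrow> (\<forall>x\<in>U. \<forall>\<^sub>F (x', y) in uniformity. x' = x \<longrightarrow> y \<in> U)"

lemma inner_fseq_superset:
  assumes "finite A" "{i. coord x i \<noteq> 0} \<subseteq> A"
  shows "inner x y = (\<Sum>i\<in>A. coord x i * coord y i)"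
  unfolding inner_fseq_def using assms by (intro sum.mono_neutral_left) auto

instance
proof
  fix x y z :: fseq and r :: real
  let ?A = "{i. coord x i \<noteq> 0} \<union> {i. coord y i \<noteq> 0}"
  have A: "finite ?A" by simp
  show "inner x y = inner y x"
    using inner_fseq_superset[OF A, of x y] inner_fseq_superset[OF A, of y x]
    by (auto simp: mult.commute)
  have "inner (x + y) z = (\<Sum>i\<in>?A. coord (x + y) i * coord z i)"
    by (rule inner_fseq_superset[OF A]) auto
  moreover have "inner x z = (\<Sum>i\<in>?A. coord x i * coord z i)"
    by (rule inner_fseq_superset[OF A]) auto
  moreover have "inner y z = (\<Sum>i\<in>?A. coord y i * coord z i)"
    by (rule inner_fseq_superset[OF A]) auto
  ultimately show "inner (x + y) z = inner x z + inner y z"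
    by (simp add: sum.distrib algebra_simps)
  have "inner (r *\<^sub>R x) y = (\<Sum>i\<in>?A. coord (r *\<^sub>R x) i * coord y i)"
    by (rule inner_fseq_superset[OF A]) auto
  moreover have "inner x y = (\<Sum>i\<in>?A. coord x i * coord y i)"
    by (rule inner_fseq_superset[OF A]) auto
  ultimately show "inner (r *\<^sub>R x) y = r * inner x y"
    by (simp add: sum_distrib_left mult.assoc)
  show "0 \<le> inner x x"
    unfolding inner_fseq_def by (intro sum_nonneg) simp
  show "inner x x = 0 \<longleftrightarrow> x = 0"
    unfolding inner_fseq_def
    by (subst sum_nonneg_eq_0_iff) (auto intro: fseq_eqI)
qed (simp_all add: norm_fseq_def dist_fseq_def sgn_fseq_def uniformity_fseq_def open_fseq_def)

end

definition Rn :: "nat \<Rightarrow> fseq set" where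
  "Rn n = {x. \<forall>i\<ge>n. coord x i = 0}"

lemma subspace_Rn: "subspace (Rn n)"
  by (auto simp: subspace_def Rn_def)

lemma inner_Rn:
  assumes "x \<in> Rn n"
  shows "inner x y = (\<Sum>i<n. coord x i * coord y i)"
  using assms by (intro inner_fseq_superset) (auto simp: Rn_def intro: leI)

lemma norm_Rn:
  assumes "x \<in> Rn n"
  shows "norm x = sqrt (\<Sum>i<n. (coord x i)\<^sup>2)"
  using assms by (simp add: norm_eq_sqrt_inner inner_Rn power2_eq_square)

lemma Rn_ex1_coord: "\<exists>!x. x \<in> Rn n \<and> (\<forall>i<n. coord x i = c i)"
proof (rule ex1I)
  define e where "e = (\<lambda>i. if i < n then c i else 0)"
  have "finite {i. e i \<noteq> 0}"
    by (rule finite_subset[of _ "{..<n}"]) (auto simp: e_def split: if_splits)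
  then have e: "coord (Abs_fseq e) = e"
    by (intro Abs_fseq_inverse) simp
  then show "Abs_fseq e \<in> Rn n \<and> (\<forall>i<n. coord (Abs_fseq e) i = c i)"
    by (simp add: Rn_def e_def)
  show "y = Abs_fseq e" if "y \<in> Rn n \<and> (\<forall>i<n. coord y i = c i)" for y
  proof (rule fseq_eqI)
    fix i show "coord y i = coord (Abs_fseq e) i"
      unfolding e using that by (cases "i < n") (auto simp: e_def Rn_def)
  qed
qed


section \<open>Function classes and the noise condition\<close>

text \<open>
  Here \<open>S\<close> is the space on which the function lives (a subspace of the ambient type) and
  \<open>G\<close> is the gradient map; requiring \<open>G x \<in> S\<close> makes it unique.
\<close>

definition is_gradient_on ::
    "('a::real_inner \<Rightarrow> 'a) \<Rightarrow> ('a \<Rightarrow> real) \<Rightarrow> 'a set \<Rightarrow> bool" where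
  "is_gradient_on G f S \<longleftrightarrow>
     (\<forall>x\<in>S. G x \<in> S \<and> (f has_derivative (\<lambda>v. G x \<bullet> v)) (at x within S))"

definition grad_convex_on ::
    "'a::real_inner set \<Rightarrow> ('a \<Rightarrow> real) \<Rightarrow> ('a \<Rightarrow> 'a) \<Rightarrow> bool" where
  "grad_convex_on S f G \<longleftrightarrow> (\<forall>x\<in>S. \<forall>y\<in>S. f x + G x \<bullet> (y - x) \<le> f y)"

definition smooth_on ::
    "real \<Rightarrow> 'a::real_inner set \<Rightarrow> ('a \<Rightarrow> real) \<Rightarrow> ('a \<Rightarrow> 'a) \<Rightarrow> bool" where
  "smooth_on L S f G \<longleftrightarrow>
     (\<forall>x\<in>S. \<forall>y\<in>S. f y \<le> f x + G x \<bullet> (y - x) + L / 2 * (norm (x - y))\<^sup>2)"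

definition relative_noise_on ::
    "real \<Rightarrow> 'a::real_inner set \<Rightarrow> ('a \<Rightarrow> 'a) \<Rightarrow> ('a \<Rightarrow> 'a) \<Rightarrow> bool" where
  "relative_noise_on \<alpha> S G Gt \<longleftrightarrow> (\<forall>x\<in>S. norm (Gt x - G x) \<le> \<alpha> * norm (G x))"


section \<open>Algorithm RE-AGM and the regularization technique\<close>

definition reagm_h :: "real \<Rightarrow> real \<Rightarrow> real" where
  "reagm_h L' a = 1 / (4 * L') * ((1 - a) / (1 + a)) powr (3 / 2)"

definition reagm_Lhat :: "real \<Rightarrow> real \<Rightarrow> real" where
  "reagm_Lhat L' a = 8 * ((1 + a) / (1 - a) ^ 3) * L'"

text \<open>
  The case \<open>a = 0\<close> encodes the convention that the logarithm of 0 to a base below 1 is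
  plus infinity (in HOL, \<open>ln 0 = 0\<close>).
\<close>

definition reagm_gamma :: "real \<Rightarrow> real \<Rightarrow> real \<Rightarrow> real" where
  "reagm_gamma L' \<mu>' a =
     (if a = 0 then 1 / 2 else min (log (\<mu>' / (2 * L')) (3 * a)) (1 / 2))"

definition reagm_s :: "real \<Rightarrow> real \<Rightarrow> real \<Rightarrow> real" where
  "reagm_s L' \<mu>' a =
     (1 + 1 / 4 * (\<mu>' / (2 * L')) powr reagm_gamma L' \<mu>' a) * (1 + a)\<^sup>2 + 2 * a\<^sup>2"

definition reagm_m :: "real \<Rightarrow> real \<Rightarrow> real \<Rightarrow> real" where
  "reagm_m L' \<mu>' a =
     (1 - 1 / 4 * (\<mu>' / (2 * L')) powr reagm_gamma L' \<mu>' a) * (1 - a)\<^sup>2 - 2 * a\<^sup>2"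

definition reagm_q :: "real \<Rightarrow> real \<Rightarrow> real \<Rightarrow> real" where
  "reagm_q L' \<mu>' a = \<mu>' / (2 * reagm_Lhat L' a)"

definition reagm_omega :: "real \<Rightarrow> real \<Rightarrow> real \<Rightarrow> real" where
  "reagm_omega L' \<mu>' a =
     (let s = reagm_s L' \<mu>' a; m = reagm_m L' \<mu>' a; q = reagm_q L' \<mu>' a
      in ((m - s) + sqrt ((s - m)\<^sup>2 + 4 * m * q)) / (2 * m))"

text \<open>The state after k iterations is the pair of u^k and x^k.\<close>

primrec reagm_state ::
    "real \<Rightarrow> real \<Rightarrow> 'a::real_vector \<Rightarrow> real \<Rightarrow> ('a \<Rightarrow> 'a) \<Rightarrow> nat \<Rightarrow> 'a \<times> 'a" where
  "reagm_state L' \<mu>' x0 a g 0 = (x0, x0)"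
| "reagm_state L' \<mu>' x0 a g (Suc k) =
     (let (u, x) = reagm_state L' \<mu>' x0 a g k;
          \<omega> = reagm_omega L' \<mu>' a;
          y = (\<omega> *\<^sub>R u + x) /\<^sub>R (1 + \<omega>)
      in ((1 - \<omega>) *\<^sub>R u + \<omega> *\<^sub>R y - (2 * \<omega> / \<mu>') *\<^sub>R g y,
          y - reagm_h L' a *\<^sub>R g y))"

definition reagm ::
    "real \<Rightarrow> real \<Rightarrow> 'a::real_vector \<Rightarrow> real \<Rightarrow> ('a \<Rightarrow> 'a) \<Rightarrow> nat \<Rightarrow> 'a" where
  "reagm L' \<mu>' x0 a g k = snd (reagm_state L' \<mu>' x0 a g k)"

text \<open>
  The estimate of the gradient of f + mu/2 |x - x0|^2 that is built from an estimate \<open>Gt\<close> of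
  the gradient of f. RE-AGM accesses the regularized function only through this estimate.
\<close>

definition regularized_estimate ::
    "real \<Rightarrow> 'a::real_vector \<Rightarrow> ('a \<Rightarrow> 'a) \<Rightarrow> 'a \<Rightarrow> 'a" where
  "regularized_estimate \<mu> x0 Gt x = Gt x + \<mu> *\<^sub>R (x - x0)"

end

theory Submission
  imports Defs
begin

text \<open>
  Take \<open>L' = L\<close>, \<open>\<mu> = \<mu>' = 2 L / \<kappa>\<close> with \<open>\<kappa> = 12 L R^2 / \<epsilon>\<close>, and \<open>a = \<kappa> powr - \<beta> / 3\<close>; then \<open>\<gamma>* = \<beta>\<close> and
  \<open>\<omega>\<close> is of order \<open>\<kappa> powr - (1 - \<beta>)\<close>. The Lyapunov function is
  \<open>F x - F z + \<mu> / 4 * |u - z|^2\<close> for the regularized function \<open>F\<close>, centred not at the minimizer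
  of \<open>F\<close> but at the minimizer \<open>z\<close> of \<open>f\<close>. The noise is relative to the gradient of \<open>f\<close> and not of \<open>F\<close>,
  but \<open>|\<nabla>f| \<le> |\<nabla>F| + \<mu> R\<close>. The first part of the noise is absorbed by the descent
  \<open>- h / 2 * |\<nabla>F|^2\<close> of the gradient step. The second part raises the Lyapunov function by at most
  \<open>\<omega>\<close> times a fixed multiple of \<open>\<mu> R^2 = \<epsilon> / 6\<close> in each step, so that with the contraction factor
  \<open>1 - \<omega>\<close> its total contribution stays below \<open>\<epsilon>\<close>.
\<close>

section \<open>One accelerated step with an inexact gradient\<close>

lemma young_norm:
  fixes p e :: "'a::real_inner"
  assumes "0 < \<nu>"
  shows "0 \<le> \<nu> * (p \<bullet> p) + 2 * (e \<bullet> p) + (e \<bullet> e) / \<nu>"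
proof -
  have "0 \<le> (\<nu> *\<^sub>R p + e) \<bullet> (\<nu> *\<^sub>R p + e) / \<nu>"
    using assms by simp
  also have "\<dots> = \<nu> * (p \<bullet> p) + 2 * (e \<bullet> p) + (e \<bullet> e) / \<nu>"
    using assms by (simp add: inner_add inner_commute field_simps)
  finally show ?thesis .
qed

text \<open>The bound is \<open>smooth\<close> plus \<omega> times \<open>z\<close> plus 1 -
  \<omega> times \<open>x\<close>. The potential weights the squared distance by
  \<open>\<nu> / 2\<close>, half of the coefficient in \<open>z\<close>; the surplus absorbs the
  noise.\<close>

lemma agm_step:
  fixes u x y z g D :: "'a::real_inner"
  assumes \<omega>: "0 < \<omega>" "\<omega> < 1" and \<nu>: "0 < \<nu>"
    and y: "y = (\<omega> *\<^sub>R u + x) /\<^sub>R (1 + \<omega>)"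
    and u': "u' = (1 - \<omega>) *\<^sub>R u + \<omega> *\<^sub>R y - (\<omega> / \<nu>) *\<^sub>R g"
    and x': "x' = y - h *\<^sub>R g"
    and z: "Fy + D \<bullet> (z - y) + \<nu> * (norm (z - y))\<^sup>2 \<le> Fz"
    and x: "Fy + D \<bullet> (x - y) \<le> Fx"
    and smooth: "Fx' \<le> Fy + D \<bullet> (x' - y) + M / 2 * (norm (y - x'))\<^sup>2"
  shows "Fx' - Fz + \<nu> / 2 * (norm (u' - z))\<^sup>2 \<le>
    (1 - \<omega>) * (Fx - Fz + \<nu> / 2 * (norm (u - z))\<^sup>2) + (\<omega>\<^sup>2 / \<nu> - h + M * h\<^sup>2) / 2 * (norm g)\<^sup>2
    - h / 2 * (norm D)\<^sup>2 + (h / 2 + \<omega> / \<nu>) * (norm (g - D))\<^sup>2"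
proof -
  define e where "e = g - D"
  define d where "d = u - y"
  define p where "p = y - z"
  have "(1 + \<omega>) *\<^sub>R y = \<omega> *\<^sub>R u + x"
    using \<omega> by (simp add: y)
  \<comment> \<open>This coupling makes the terms in \<open>g \<bullet> d\<close> from the
    \<open>u\<close>-step and from convexity at \<open>x\<close> cancel.\<close>
  then have xd: "x - y = - \<omega> *\<^sub>R d"
    by (simp add: d_def algebra_simps)
  have D: "D = g - e" by (simp add: e_def)
  have zy: "z - y = - p" by (simp add: p_def)
  have uz: "u - z = p + d" by (simp add: p_def d_def)
  have u'z: "u' - z = p + (1 - \<omega>) *\<^sub>R d - (\<omega> / \<nu>) *\<^sub>R g"
    by (simp add: p_def d_def u' algebra_simps)
  have N1: "\<nu> / 2 * (norm (u' - z))\<^sup>2 = \<nu> / 2 * (p \<bullet> p + (1 - \<omega>)\<^sup>2 * (d \<bullet> d) + 2 * (1 - \<omega>) * (p \<bullet> d))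
      - \<omega> * (g \<bullet> p) - \<omega> * (1 - \<omega>) * (g \<bullet> d) + \<omega>\<^sup>2 / \<nu> / 2 * (g \<bullet> g)"
    unfolding u'z power2_norm_eq_inner using \<nu>
    by (simp add: inner_add inner_diff inner_commute power2_eq_square field_simps)
  have N2: "\<nu> / 2 * (norm (u - z))\<^sup>2 = \<nu> / 2 * (p \<bullet> p + d \<bullet> d + 2 * (p \<bullet> d))"
    unfolding uz power2_norm_eq_inner by (simp add: inner_add inner_commute)
  have z2: "Fy - g \<bullet> p + e \<bullet> p + \<nu> * (p \<bullet> p) \<le> Fz"
    using z by (simp add: zy D power2_norm_eq_inner inner_diff)
  have x2: "Fy - \<omega> * (g \<bullet> d) + \<omega> * (e \<bullet> d) \<le> Fx"
    using x by (simp add: xd D inner_diff algebra_simps)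
  have D2: "(norm D)\<^sup>2 = g \<bullet> g - 2 * (g \<bullet> e) + e \<bullet> e"
    by (simp add: D power2_norm_eq_inner inner_diff inner_commute)
  have s2: "Fx' \<le> Fy - h * (g \<bullet> g) + h * (g \<bullet> e) + M * h\<^sup>2 / 2 * (g \<bullet> g)"
    using smooth
    by (simp add: x' D power2_norm_eq_inner[symmetric] power_mult_distrib inner_diff inner_commute
        algebra_simps)
  define E where "E = (e \<bullet> e) / \<nu>"
  define W where "W = \<omega>\<^sup>2 / \<nu>"
  have E: "\<omega> / \<nu> * (e \<bullet> e) = \<omega> * E" by (simp add: E_def)
  \<comment> \<open>Young's inequality bounds the products of the noise \<open>e\<close> with
    \<open>p\<close> and \<open>d\<close>. The squares it costs are exactly the surplus in
    \<open>p \<bullet> p\<close> and \<open>d \<bullet> d\<close>. The last summand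
    \<open>\<omega>\<^sup>2 / 2 * E\<close> rounds the coefficient of \<open>E\<close> up to
    \<omega>.\<close>
  have "0 \<le> \<omega> / 2 * (\<nu> * (p \<bullet> p) + 2 * (e \<bullet> p) + E)"
    using \<omega> young_norm[OF \<nu>, of p e] unfolding E_def by (intro mult_nonneg_nonneg) auto
  moreover have "0 \<le> \<omega> * (1 - \<omega>) / 2 * (\<nu> * (d \<bullet> d) + 2 * (e \<bullet> d) + E)"
    using \<omega> young_norm[OF \<nu>, of d e] unfolding E_def by (intro mult_nonneg_nonneg) auto
  moreover have "\<omega> * (Fy - g \<bullet> p + e \<bullet> p + \<nu> * (p \<bullet> p)) \<le> \<omega> * Fz"
    using \<omega> z2 by (intro mult_left_mono) auto
  moreover have "(1 - \<omega>) * (Fy - \<omega> * (g \<bullet> d) + \<omega> * (e \<bullet> d)) \<le> (1 - \<omega>) * Fx"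
    using \<omega> x2 by (intro mult_left_mono) auto
  moreover have "0 \<le> \<omega>\<^sup>2 / 2 * E"
    using \<nu> by (simp add: E_def)
  ultimately have
    "Fx' - Fz + (\<nu> / 2 * (p \<bullet> p + (1 - \<omega>)\<^sup>2 * (d \<bullet> d) + 2 * (1 - \<omega>) * (p \<bullet> d))
      - \<omega> * (g \<bullet> p) - \<omega> * (1 - \<omega>) * (g \<bullet> d) + W / 2 * (g \<bullet> g)) \<le>
    (1 - \<omega>) * (Fx - Fz + \<nu> / 2 * (p \<bullet> p + d \<bullet> d + 2 * (p \<bullet> d))) + (W - h + M * h\<^sup>2) / 2 * (g \<bullet> g)
    - h / 2 * (g \<bullet> g - 2 * (g \<bullet> e) + e \<bullet> e) + (h / 2 * (e \<bullet> e) + \<omega> * E)"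
    using s2
    by (simp add: algebra_simps power2_eq_square add_divide_distrib diff_divide_distrib)
  then show ?thesis
    unfolding N1 N2 D2 e_def[symmetric] W_def[symmetric] distrib_right[of "h / 2"]
      power2_norm_eq_inner[of g] power2_norm_eq_inner[of e] E .
qed

section \<open>Gradients of the function and of its regularization\<close>

text \<open>Adding \<open>\<mu> (y - z)\<close>, which makes a nonobtuse angle with \<open>G\<close>, cannot decrease the norm.\<close>

lemma norm_grad_le_regularized:
  fixes G y z x0 :: "'a::real_inner"
  assumes "0 \<le> \<mu>" and "0 \<le> G \<bullet> (y - z)"
  shows "norm G \<le> norm (G + \<mu> *\<^sub>R (y - x0)) + \<mu> * norm (x0 - z)"
proof -
  have "(norm G)\<^sup>2 \<le> (norm (G + \<mu> *\<^sub>R (y - z)))\<^sup>2"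
    using assms unfolding power2_norm_eq_inner
    by (simp add: inner_add inner_commute)
  then have "norm G \<le> norm (G + \<mu> *\<^sub>R (y - z))"
    by (rule power2_le_imp_le) simp
  also have "G + \<mu> *\<^sub>R (y - z) = (G + \<mu> *\<^sub>R (y - x0)) + \<mu> *\<^sub>R (x0 - z)"
    by (simp add: algebra_simps)
  also have "norm \<dots> \<le> norm (G + \<mu> *\<^sub>R (y - x0)) + \<mu> * norm (x0 - z)"
    using assms norm_triangle_ineq[of "G + \<mu> *\<^sub>R (y - x0)" "\<mu> *\<^sub>R (x0 - z)"] by simp
  finally show ?thesis .
qed

text \<open>Otherwise a gradient step of length 1/L, which stays in \<open>S\<close>, would lower
  \<open>f\<close> by at least |G z|^2 / (2 L).\<close>

lemma gradient_zero_at_min: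
  assumes S: "subspace S" and G: "G z \<in> S" and L: "0 < L"
    and smooth: "smooth_on L S f G" and z: "z \<in> S" "\<forall>x\<in>S. f z \<le> f x"
  shows "G z = 0"
proof -
  define w where "w = z - (1 / L) *\<^sub>R G z"
  have w: "w \<in> S"
    unfolding w_def using S z G by (intro subspace_diff subspace_scale)
  have "f w \<le> f z + G z \<bullet> (w - z) + L / 2 * (norm (z - w))\<^sup>2"
    using smooth z w unfolding smooth_on_def by blast
  also have "\<dots> = f z - (norm (G z))\<^sup>2 / (2 * L)"
    using L by (simp add: w_def power2_norm_eq_inner[symmetric] power_divide field_simps power2_eq_square)
  finally have "(norm (G z))\<^sup>2 / (2 * L) \<le> 0"
    using z w by force
  then show ?thesis using L by (simp add: divide_le_0_iff)
qed

text \<open>For a quadratic the second-order expansion is exact. Added to the inequalities for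
  \<open>f\<close>, it yields strong convexity with modulus \<mu> and smoothness with constant L +
  \<mu>.\<close>

lemma regularizer_expansion:
  fixes x y x0 :: "'a::real_inner"
  shows "\<mu> / 2 * (norm (x - x0))\<^sup>2 =
    \<mu> / 2 * (norm (y - x0))\<^sup>2 + (\<mu> *\<^sub>R (y - x0)) \<bullet> (x - y) + \<mu> / 2 * (norm (x - y))\<^sup>2"
  unfolding power2_norm_eq_inner by (simp add: inner_diff inner_commute algebra_simps)

section \<open>Estimates of the parameters of the method\<close>

text \<open>Here 1/\<kappa> is the base \<mu>' / (2 L'), \<open>t\<close> is 3 a, and \<nu> is half
  of the regularization parameter. The bound on \<kappa> expresses \<epsilon> < L R^2.\<close>

locale reagm_parameters =
  fixes L \<kappa> \<beta> t :: real
  assumes L: "0 < L" and \<kappa>: "12 < \<kappa>" and \<beta>: "0 \<le> \<beta>" "\<beta> \<le> 1 / 2"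
    and t_def: "t = \<kappa> powr - \<beta>"
begin

abbreviation "\<nu> \<equiv> L / \<kappa>"
abbreviation "\<omega> \<equiv> reagm_omega L (2 * \<nu>) (t / 3)"
abbreviation "h \<equiv> reagm_h L (t / 3)"

text \<open>The last bound is \<beta> \<le> 1/2 in the form that later controls \<omega> and
  \<omega>^2 / \<nu>.\<close>

lemma t_bounds: "0 < t" "t \<le> 1" "1 / \<kappa> \<le> t\<^sup>2"
proof -
  show "0 < t" using \<kappa> by (simp add: t_def)
  have "\<kappa> powr - \<beta> \<le> \<kappa> powr 0"
    using \<kappa> \<beta> by (intro powr_mono) auto
  then show "t \<le> 1" using \<kappa> by (simp add: t_def)
  have "\<kappa> powr - 1 \<le> \<kappa> powr (- \<beta> + - \<beta>)"
    using \<kappa> \<beta> by (intro powr_mono) auto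
  also have "\<dots> = t\<^sup>2"
    by (simp only: powr_add t_def power2_eq_square)
  finally show "1 / \<kappa> \<le> t\<^sup>2"
    using \<kappa> by (simp add: powr_minus_divide)
qed

text \<open>The logarithm of 3 a = t to base 1/\<kappa> is \<beta>, and the minimum with 1/2 keeps
  it. So \<open>s\<close> and \<open>m\<close> become polynomials in \<open>t\<close>. Since a is
  tied to the largest admissible noise and not to \<alpha>, it is positive even if \<alpha> =
  0.\<close>

lemma powr_gamma: "(2 * \<nu> / (2 * L)) powr reagm_gamma L (2 * \<nu>) (t / 3) = t"
proof -
  have base: "2 * \<nu> / (2 * L) = 1 / \<kappa>" using L by simp
  have "log (1 / \<kappa>) t = \<beta>"
    using \<kappa> by (simp add: t_def log_def ln_powr ln_div)
  then have "reagm_gamma L (2 * \<nu>) (t / 3) = \<beta>"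
    using t_bounds \<beta> base by (simp add: reagm_gamma_def)
  then show ?thesis
    using \<kappa> unfolding base by (simp add: t_def powr_divide powr_minus_divide)
qed

lemma h_bounds: "7 / 80 / L \<le> h" "h \<le> 1 / 4 / L"
proof -
  define w where "w = (1 - t / 3) / (1 + t / 3)"
  have w: "1 / 2 \<le> w" "w \<le> 1"
    using t_bounds by (simp_all add: w_def field_simps)
  have "w powr (3 / 2) = w powr (1 + 1 / 2)" by simp
  also have "\<dots> = w * sqrt w"
    using w by (subst powr_add) (simp add: powr_half_sqrt)
  finally have eq: "h = 1 / (4 * L) * (w * sqrt w)"
    by (simp add: reagm_h_def w_def)
  \<comment> \<open>A rational lower bound for the root of 1/2; then 7/80 = 1/4 * 1/2 *
    7/10.\<close>
  have "7 / 10 \<le> sqrt w"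
    using w by (intro real_le_rsqrt) (simp add: power2_eq_square)
  then have "1 / 2 * (7 / 10) \<le> w * sqrt w"
    using w by (intro mult_mono) auto
  moreover have "w * sqrt w \<le> 1 * 1"
    using w by (intro mult_mono) auto
  ultimately show "7 / 80 / L \<le> h" "h \<le> 1 / 4 / L"
    unfolding eq using L by (simp_all add: field_simps)
qed

text \<open>Up to constants \<omega> is q / (s - m), where q is of order 1/\<kappa> and s - m of
  order t, because the constant terms of s and m cancel.\<close>

lemma omega_bounds: "1 / (85 * \<kappa> * t) \<le> \<omega>" "\<omega> \<le> 3 / (44 * \<kappa> * t)"
proof -
  define s where "s = reagm_s L (2 * \<nu>) (t / 3)"
  define m where "m = reagm_m L (2 * \<nu>) (t / 3)"
  define q where "q = reagm_q L (2 * \<nu>) (t / 3)"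
  have s: "s = (1 + t / 4) * (1 + t / 3)\<^sup>2 + 2 * (t / 3)\<^sup>2"
    unfolding s_def reagm_s_def powr_gamma by simp
  have m: "m = (1 - t / 4) * (1 - t / 3)\<^sup>2 - 2 * (t / 3)\<^sup>2"
    unfolding m_def reagm_m_def powr_gamma by simp
  have q: "q = 1 / (8 * \<kappa>) * ((1 - t / 3) ^ 3 / (1 + t / 3))"
    unfolding q_def reagm_q_def reagm_Lhat_def using L by simp
  note t = t_bounds
  have "(3 / 4) * (2 / 3)\<^sup>2 \<le> (1 - t / 4) * (1 - t / 3)\<^sup>2"
    using t by (intro mult_mono power_mono) auto
  moreover have "(3 / 4) * (2 / 3)\<^sup>2 = (1 / 3 :: real)"
    by (simp add: power2_eq_square)
  moreover have "(t / 3)\<^sup>2 \<le> (1 / 3)\<^sup>2"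
    using t by (intro power_mono) auto
  moreover have "(1 / 3)\<^sup>2 = (1 / 9 :: real)"
    by (simp add: power2_eq_square)
  ultimately have m0: "0 < m"
    unfolding m by linarith
  have "(1 - t / 4) * (1 - t / 3)\<^sup>2 \<le> 1 * 1\<^sup>2"
    using t by (intro mult_mono power_mono) auto
  then have "(1 - t / 4) * (1 - t / 3)\<^sup>2 \<le> 1"
    by (simp only: power_one mult_1)
  then have m1: "m \<le> 1"
    unfolding m using zero_le_power2[of "t / 3"] by linarith
  have sm: "s - m = t * (11 / 6 + 4 / 9 * t + t\<^sup>2 / 18)"
    unfolding s m by (simp add: field_simps power2_eq_square)
  \<comment> \<open>The second factor of \<open>sm\<close> increases from 11/6 at t = 0 to 11/6 +
    4/9 + 1/18 = 7/3 at t = 1.\<close>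
  have "t\<^sup>2 \<le> 1" using t by (simp add: power_le_one)
  then have "11 / 6 + 4 / 9 * t + t\<^sup>2 / 18 \<le> 7 / 3" using t by linarith
  then have sm2: "s - m \<le> t * (7 / 3)"
    unfolding sm using t by (intro mult_left_mono) auto
  have sm1: "t * (11 / 6) \<le> s - m"
    unfolding sm using t by (intro mult_left_mono) auto
  have "(2 / 3) ^ 3 / (4 / 3) \<le> (1 - t / 3) ^ 3 / (1 + t / 3)"
    using t by (intro frac_le power_mono) auto
  then have "1 / (8 * \<kappa>) * ((2 / 3) ^ 3 / (4 / 3)) \<le> q"
    unfolding q using \<kappa> by (intro mult_left_mono) auto
  then have q1: "1 / (36 * \<kappa>) \<le> q"
    by (simp add: power3_eq_cube)
  have "(1 - t / 3) ^ 3 / (1 + t / 3) \<le> 1 ^ 3 / 1"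
    using t by (intro frac_le power_mono) auto
  then have "q \<le> 1 / (8 * \<kappa>) * (1 ^ 3 / 1)"
    unfolding q using \<kappa> by (intro mult_left_mono) auto
  then have q2: "q \<le> 1 / (8 * \<kappa>)" by simp
  have "0 < 1 / (36 * \<kappa>)" using \<kappa> by simp
  with q1 have q0: "0 < q" by linarith
  have "0 < t * (11 / 6)" using t by simp
  with sm1 have sm0: "0 < s - m" by linarith
  define r where "r = sqrt ((s - m)\<^sup>2 + 4 * m * q)"
  have r2: "r\<^sup>2 = (s - m)\<^sup>2 + 4 * m * q"
    unfolding r_def using m0 q0 by simp
  have "s - m < r"
    unfolding r_def using m0 q0 sm0 by (intro real_less_rsqrt) simp
  have \<omega>: "\<omega> = ((m - s) + r) / (2 * m)"
    by (simp add: reagm_omega_def Let_def r_def s_def m_def q_def)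
  have pos: "0 < \<omega>"
    unfolding \<omega> using m0 \<open>s - m < r\<close> by simp
  \<comment> \<open>Both bounds rest on the quadratic equation and on positivity of the root, not on
    the closed formula.\<close>
  have "r = 2 * m * \<omega> + (s - m)" unfolding \<omega> using m0 by simp
  then have "(2 * m * \<omega> + (s - m))\<^sup>2 = (s - m)\<^sup>2 + 4 * m * q" using r2 by simp
  then have "4 * m * (m * \<omega>\<^sup>2 + (s - m) * \<omega>) = 4 * m * q"
    by (simp add: power2_eq_square algebra_simps)
  then have root: "m * \<omega>\<^sup>2 + (s - m) * \<omega> = q" using m0 by simp
  \<comment> \<open>Dropping the quadratic term leaves \<omega> \<le> q / (s - m), and 3/44 = (1/8)
    / (11/6).\<close>
  have "t * (11 / 6) * \<omega> \<le> (s - m) * \<omega>"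
    using sm1 pos by (intro mult_right_mono) auto
  also have "\<dots> \<le> q"
    using root m0 by (simp flip: root)
  also note q2
  finally show "\<omega> \<le> 3 / (44 * \<kappa> * t)"
    using t \<kappa> by (simp add: field_simps)
  show "1 / (85 * \<kappa> * t) \<le> \<omega>"
  proof (rule ccontr)
    \<comment> \<open>At \<open>w\<close> the left side of \<open>root\<close> is still at most 1 /
      (36 \<kappa>). With 84 instead of 85 the bound on the linear term alone would reach this
      value; the quadratic term fits into the small gap.\<close>
    define w where "w = 1 / (85 * \<kappa> * t)"
    assume "\<not> 1 / (85 * \<kappa> * t) \<le> \<omega>"
    then have less: "\<omega> < w" by (simp add: w_def)
    have w0: "0 < w" using t \<kappa> by (simp add: w_def)
    have "m * \<omega>\<^sup>2 \<le> m * w\<^sup>2"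
      using m0 pos less by (intro mult_left_mono power_mono) auto
    moreover have "m * w\<^sup>2 \<le> 1 * w\<^sup>2"
      using m1 by (intro mult_right_mono) auto
    moreover have "w\<^sup>2 \<le> 1 / (7225 * \<kappa>)"
      using t \<kappa> by (simp add: w_def power2_eq_square field_simps)
    moreover have "(s - m) * \<omega> < (s - m) * w"
      using sm0 less by simp
    moreover have "(s - m) * w \<le> t * (7 / 3) * w"
      using sm2 w0 by (intro mult_right_mono) auto
    moreover have "t * (7 / 3) * w = 7 / (255 * \<kappa>)"
      using t \<kappa> by (simp add: w_def)
    moreover have "1 / (7225 * \<kappa>) + 7 / (255 * \<kappa>) \<le> 1 / (36 * \<kappa>)"
      using \<kappa> by (simp add: field_simps)
    ultimately show False using root q1 by linarith
  qed
qed

lemma omega_less_1: "0 < \<omega>" "\<omega> < 1"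
proof -
  have "0 < 1 / (85 * \<kappa> * t)" using t_bounds \<kappa> by simp
  then show "0 < \<omega>" using omega_bounds(1) by linarith
  have "1 * t \<ge> t * t" using t_bounds by (intro mult_right_mono) auto
  then have "1 / \<kappa> \<le> t" using t_bounds unfolding power2_eq_square by linarith
  then have "1 \<le> \<kappa> * t" using \<kappa> by (simp add: field_simps)
  then have "3 / (44 * \<kappa> * t) \<le> 3 / 44" by (simp add: field_simps)
  then show "\<omega> < 1" using omega_bounds(2) by linarith
qed

lemma h_pos: "0 < h"
proof -
  have "0 < 7 / 80 / L" using L by simp
  then show ?thesis using h_bounds(1) by linarith
qed

text \<open>The \<open>u\<close>-step amplifies the squared noise by \<omega> / \<nu>, at most 1/t
  times h. The factor t^2 in the squared noise level pays for this.\<close>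

lemma omega_le_h: "\<omega> / \<nu> \<le> h / t"
proof -
  have "\<omega> / \<nu> \<le> 3 / (44 * \<kappa> * t) / \<nu>"
    using omega_bounds L \<kappa> by (intro divide_right_mono) auto
  also have "\<dots> \<le> 7 / 80 / L / t"
    using L \<kappa> t_bounds by (simp add: field_simps)
  also have "\<dots> \<le> h / t"
    using h_bounds t_bounds by (intro divide_right_mono) auto
  finally show ?thesis .
qed

text \<open>This removes the term in |g|^2 from \<open>agm_step\<close>. The step size is built from
  L although the regularized function has smoothness constant L + 2 \<nu> \<le> 2 L; h \<le> 1 / (4
  L) makes the last summand at most h/2, and \<omega>^2 / \<nu> is at most h/4.\<close>

lemma step_coefficient_nonpos: "\<omega>\<^sup>2 / \<nu> - h + (L + 2 * \<nu>) * h\<^sup>2 \<le> 0"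
proof -
  have "\<omega>\<^sup>2 \<le> (3 / (44 * \<kappa> * t))\<^sup>2"
    using omega_bounds omega_less_1 by (intro power_mono) auto
  also have "\<dots> = 9 / 1936 / \<kappa>\<^sup>2 / t\<^sup>2"
    by (simp add: power_divide power_mult_distrib)
  also have "\<dots> \<le> 9 / 1936 / \<kappa>\<^sup>2 / (1 / \<kappa>)"
    using t_bounds \<kappa> by (intro divide_left_mono) auto
  also have "\<dots> = 9 / 1936 / \<kappa>"
    using \<kappa> by (simp add: power2_eq_square)
  finally have "\<omega>\<^sup>2 / \<nu> \<le> 9 / 1936 / \<kappa> / \<nu>"
    using L \<kappa> by (intro divide_right_mono) auto
  also have "\<dots> = 9 / 1936 / L" using \<kappa> by simp
  also have "\<dots> \<le> 1 / 4 * (7 / 80 / L)" using L by (simp add: field_simps)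
  also have "\<dots> \<le> 1 / 4 * h" using h_bounds by (intro mult_left_mono) auto
  finally have 1: "\<omega>\<^sup>2 / \<nu> \<le> 1 / 4 * h" .
  have "(L + 2 * \<nu>) * h\<^sup>2 \<le> (2 * L) * h\<^sup>2"
    using L \<kappa> by (intro mult_right_mono) (auto simp: field_simps)
  also have "\<dots> = 2 * L * h * h" by (simp add: power2_eq_square)
  also have "\<dots> \<le> 2 * L * h * (1 / 4 / L)"
    using L h_bounds h_pos by (intro mult_left_mono) auto
  also have "\<dots> = 1 / 2 * h" using L by simp
  finally show ?thesis using 1 h_pos by linarith
qed

text \<open>The part of the noise proportional to |D|^2 carries a further factor 3, so this bound
  turns it into h/2 |D|^2, just the descent available in \<open>agm_step\<close>.\<close>

lemma noise_coefficient_le: "t\<^sup>2 / 9 * (h / 2 + \<omega> / \<nu>) \<le> h / 6"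
proof -
  have "t\<^sup>2 / 9 * (h / 2 + \<omega> / \<nu>) \<le> t\<^sup>2 / 9 * (h / 2 + h / t)"
    using omega_le_h by (intro mult_left_mono) auto
  also have "\<dots> = (t\<^sup>2 / 2 + t) * (h / 9)"
    using t_bounds by (simp add: field_simps power2_eq_square)
  also have "\<dots> \<le> (1 / 2 + 1) * (h / 9)"
    using t_bounds h_pos by (intro mult_right_mono add_mono) (auto intro: power_le_one)
  finally show ?thesis by simp
qed

text \<open>This is the part of the noise due to \<mu> R. The factor \<omega> on the right matters:
  summed against powers of 1 - \<omega> it gives a constant.\<close>

lemma noise_floor_le: "t\<^sup>2 / 9 * (h / 2 + \<omega> / \<nu>) * (3 / 2 * (2 * \<nu>)\<^sup>2) \<le> 31 / 4 * (\<omega> * \<nu>)"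
proof -
  have \<nu>: "0 < \<nu>" using L \<kappa> by simp
  have "\<nu> * h \<le> \<nu> * (1 / 4 / L)"
    using h_bounds \<nu> by (intro mult_left_mono) auto
  \<comment> \<open>The lower bound on \<omega> trades 1 / (4 \<kappa>) for a multiple of \<omega>;
    below, 31/4 = 85/12 + 2/3.\<close>
  also have "\<dots> = 85 / 4 * t * (1 / (85 * \<kappa> * t))" using L \<kappa> t_bounds by simp
  also have "\<dots> \<le> 85 / 4 * t * \<omega>"
    using t_bounds omega_bounds by (intro mult_left_mono) auto
  also have "\<dots> \<le> 85 / 4 * 1 * \<omega>"
    using t_bounds omega_less_1 by (intro mult_right_mono mult_left_mono) auto
  finally have "\<nu> * h / 3 \<le> 85 / 4 * 1 * \<omega> / 3"
    by (rule divide_right_mono) simp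
  then have *: "\<nu> * h / 3 + 2 / 3 * \<omega> \<le> 31 / 4 * \<omega>" by linarith
  have "t\<^sup>2 / 9 * (h / 2 + \<omega> / \<nu>) * (3 / 2 * (2 * \<nu>)\<^sup>2) = t\<^sup>2 * (\<nu> * (\<nu> * h / 3 + 2 / 3 * \<omega>))"
    using \<nu> L \<kappa> by (simp add: field_simps power2_eq_square)
  also have "\<dots> \<le> 1 * (\<nu> * (31 / 4 * \<omega>))"
    using * \<nu> t_bounds h_pos omega_less_1 L \<kappa>
    by (intro mult_mono mult_left_mono) (auto intro!: power_le_one add_nonneg_nonneg)
  finally show ?thesis by (simp add: mult.commute)
qed

section \<open>Linear convergence down to a noise floor\<close>

text \<open>Of the constant 35/4, the noise accounts for 31/4 and the value of the regularizer at
  \<open>z\<close> for 1.\<close>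

lemma reagm_convergence:
  fixes f :: "'a::real_inner \<Rightarrow> real"
  assumes S: "subspace S" and G: "\<forall>x\<in>S. G x \<in> S" and Gt: "\<forall>x\<in>S. Gt x \<in> S"
    and convex: "grad_convex_on S f G" and smooth: "smooth_on L S f G"
    and z: "z \<in> S" "\<forall>x\<in>S. f z \<le> f x" and x0: "x0 \<in> S" and R: "norm (x0 - z) = R"
    and noise: "relative_noise_on \<alpha> S G Gt" and \<alpha>: "0 \<le> \<alpha>" "\<alpha> \<le> t / 3"
  shows "f (reagm L (2 * \<nu>) x0 (t / 3) (regularized_estimate (2 * \<nu>) x0 Gt) k) - f z \<le>
    (1 - \<omega>) ^ k * (L / 2 * R\<^sup>2) + 35 / 4 * (\<nu> * R\<^sup>2)"
proof -
  define g where "g = regularized_estimate (2 * \<nu>) x0 Gt"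
  define F where "F = (\<lambda>x. f x + 2 * \<nu> / 2 * (norm (x - x0))\<^sup>2)"
  define D where "D = (\<lambda>x. G x + (2 * \<nu>) *\<^sub>R (x - x0))"
  define st where "st = reagm_state L (2 * \<nu>) x0 (t / 3) g"
  have \<nu>: "0 < \<nu>" using L \<kappa> by simp
  have Gz: "G z = 0"
    using gradient_zero_at_min[OF S _ L smooth z] G z by blast
  have F_convex: "F y + D y \<bullet> (x - y) + \<nu> * (norm (x - y))\<^sup>2 \<le> F x" if "x \<in> S" "y \<in> S" for x y
  proof -
    have "f y + G y \<bullet> (x - y) \<le> f x"
      using convex that unfolding grad_convex_on_def by blast
    then show ?thesis
      unfolding F_def D_def using regularizer_expansion[of "2 * \<nu>" x x0 y]
      by (simp add: inner_add)
  qed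
  have F_smooth: "F x \<le> F y + D y \<bullet> (x - y) + (L + 2 * \<nu>) / 2 * (norm (y - x))\<^sup>2"
    if "x \<in> S" "y \<in> S" for x y
  proof -
    have "f x \<le> f y + G y \<bullet> (x - y) + L / 2 * (norm (y - x))\<^sup>2"
      using smooth that unfolding smooth_on_def by blast
    then show ?thesis
      unfolding F_def D_def
      using regularizer_expansion[of "2 * \<nu>" x x0 y]
      by (simp add: inner_add norm_minus_commute[of y x] algebra_simps add_divide_distrib)
  qed
  \<comment> \<open>The weight 3 is matched to \<open>noise_coefficient_le\<close>.\<close>
  have young: "(a + b)\<^sup>2 \<le> 3 * a\<^sup>2 + 3 / 2 * b\<^sup>2" for a b :: real
    using zero_le_power2[of "2 * a - b"] by (simp add: power2_eq_square algebra_simps)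
  have error: "(norm (g y - D y))\<^sup>2 \<le> t\<^sup>2 / 9 * (3 * (norm (D y))\<^sup>2 + 3 / 2 * (2 * \<nu>)\<^sup>2 * R\<^sup>2)"
    if y: "y \<in> S" for y
  proof -
    have "f y + G y \<bullet> (z - y) \<le> f z"
      using convex y z unfolding grad_convex_on_def by blast
    moreover have "f z \<le> f y" using y z by blast
    ultimately have "0 \<le> G y \<bullet> (y - z)"
      by (simp add: inner_diff)
    then have GD: "norm (G y) \<le> norm (D y) + 2 * \<nu> * R"
      unfolding D_def using norm_grad_le_regularized[of "2 * \<nu>" "G y" y z x0] \<nu> R by simp
    have "norm (g y - D y) = norm (Gt y - G y)"
      by (simp add: g_def D_def regularized_estimate_def)
    also have "\<dots> \<le> \<alpha> * norm (G y)"
      using noise y unfolding relative_noise_on_def by blast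
    also have "\<dots> \<le> t / 3 * (norm (D y) + 2 * \<nu> * R)"
      using GD \<alpha> t_bounds by (intro mult_mono) auto
    finally have "(norm (g y - D y))\<^sup>2 \<le> (t / 3 * (norm (D y) + 2 * \<nu> * R))\<^sup>2"
      by (intro power_mono) auto
    also have "\<dots> = t\<^sup>2 / 9 * (norm (D y) + 2 * \<nu> * R)\<^sup>2"
      by (simp add: power_mult_distrib power_divide)
    also have "\<dots> \<le> t\<^sup>2 / 9 * (3 * (norm (D y))\<^sup>2 + 3 / 2 * (2 * \<nu> * R)\<^sup>2)"
      using young by (intro mult_left_mono) auto
    also have "3 / 2 * (2 * \<nu> * R)\<^sup>2 = 3 / 2 * (2 * \<nu>)\<^sup>2 * R\<^sup>2"
      by (simp only: power_mult_distrib mult.assoc)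
    finally show ?thesis .
  qed
  \<comment> \<open>\<open>B\<close> is the fixed point of the recursion that maps v to (1 -
    \<omega>) v + \<omega> B.\<close>
  define B where "B = 31 / 4 * (\<nu> * R\<^sup>2)"
  define \<Phi> where "\<Phi> = (\<lambda>(u, x). F x - F z + \<nu> / 2 * (norm (u - z))\<^sup>2)"
  have main: "fst (st k) \<in> S \<and> snd (st k) \<in> S \<and> \<Phi> (st k) \<le> (1 - \<omega>) ^ k * (L / 2 * R\<^sup>2) + B" for k
  proof (induction k)
    case 0
    have "f x0 \<le> f z + G z \<bullet> (x0 - z) + L / 2 * (norm (z - x0))\<^sup>2"
      using smooth z x0 unfolding smooth_on_def by blast
    then have "f x0 - f z \<le> L / 2 * R\<^sup>2"
      using R by (simp add: Gz norm_minus_commute)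
    moreover have "0 \<le> B" "0 \<le> \<nu> * R\<^sup>2" unfolding B_def using L \<kappa> by simp_all
    \<comment> \<open>The regularizer vanishes at \<open>x0\<close> and equals \<nu> R^2 at
      \<open>z\<close>, which outweighs the distance term \<nu> R^2 / 2.\<close>
    ultimately show ?case
      using x0 R by (simp add: st_def \<Phi>_def F_def norm_minus_commute[of z])
  next
    case (Suc k)
    obtain u x where ux: "st k = (u, x)" by (cases "st k")
    with Suc have u: "u \<in> S" and x: "x \<in> S"
      and IH: "F x - F z + \<nu> / 2 * (norm (u - z))\<^sup>2 \<le> (1 - \<omega>) ^ k * (L / 2 * R\<^sup>2) + B"
      by (auto simp: \<Phi>_def)
    define y where "y = (\<omega> *\<^sub>R u + x) /\<^sub>R (1 + \<omega>)"
    define u' where "u' = (1 - \<omega>) *\<^sub>R u + \<omega> *\<^sub>R y - (\<omega> / \<nu>) *\<^sub>R g y"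
    define x' where "x' = y - h *\<^sub>R g y"
    have "2 * \<omega> / (2 * \<nu>) = \<omega> / \<nu>" by simp
    then have st': "st (Suc k) = (u', x')"
      using ux unfolding st_def u'_def x'_def y_def by (simp add: Let_def)
    have y: "y \<in> S"
      unfolding y_def using S u x by (intro subspace_scale subspace_add)
    have gy: "g y \<in> S"
      unfolding g_def regularized_estimate_def using S Gt y x0
      by (intro subspace_scale subspace_add subspace_diff) auto
    have u': "u' \<in> S" and x': "x' \<in> S"
      unfolding u'_def x'_def using S u y gy
      by (auto intro!: subspace_scale subspace_add subspace_diff)
    have "0 \<le> \<nu> * (norm (x - y))\<^sup>2" using L \<kappa> by simp
    then have Fx: "F y + D y \<bullet> (x - y) \<le> F x" using F_convex[OF x y] by linarith
    let ?E = "h / 2 + \<omega> / \<nu>"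
    have E: "0 \<le> ?E" using h_pos omega_less_1 L \<kappa> by simp
    have step: "F x' - F z + \<nu> / 2 * (norm (u' - z))\<^sup>2 \<le>
        (1 - \<omega>) * (F x - F z + \<nu> / 2 * (norm (u - z))\<^sup>2)
        + (\<omega>\<^sup>2 / \<nu> - h + (L + 2 * \<nu>) * h\<^sup>2) / 2 * (norm (g y))\<^sup>2
        - h / 2 * (norm (D y))\<^sup>2 + ?E * (norm (g y - D y))\<^sup>2"
      by (rule agm_step[OF omega_less_1 \<nu> y_def u'_def x'_def F_convex[OF z(1) y] Fx F_smooth[OF x' y]])
    have "(\<omega>\<^sup>2 / \<nu> - h + (L + 2 * \<nu>) * h\<^sup>2) / 2 * (norm (g y))\<^sup>2 \<le> 0"
      using step_coefficient_nonpos by (intro mult_nonpos_nonneg) auto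
    moreover have "?E * (norm (g y - D y))\<^sup>2 \<le> h / 2 * (norm (D y))\<^sup>2 + \<omega> * B"
    proof -
      have "?E * (norm (g y - D y))\<^sup>2 \<le>
          ?E * (t\<^sup>2 / 9 * (3 * (norm (D y))\<^sup>2 + 3 / 2 * (2 * \<nu>)\<^sup>2 * R\<^sup>2))"
        using error[OF y] E by (rule mult_left_mono)
      also have "\<dots> = t\<^sup>2 / 9 * ?E * (3 * (norm (D y))\<^sup>2)
          + t\<^sup>2 / 9 * ?E * (3 / 2 * (2 * \<nu>)\<^sup>2) * R\<^sup>2"
        by (simp only: ring_distribs mult_ac)
      also have "\<dots> \<le> h / 6 * (3 * (norm (D y))\<^sup>2) + 31 / 4 * (\<omega> * \<nu>) * R\<^sup>2"
        using noise_coefficient_le noise_floor_le by (intro add_mono mult_right_mono) auto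
      finally show ?thesis by (simp add: B_def mult_ac)
    qed
    moreover have "(1 - \<omega>) * (F x - F z + \<nu> / 2 * (norm (u - z))\<^sup>2) \<le>
        (1 - \<omega>) * ((1 - \<omega>) ^ k * (L / 2 * R\<^sup>2) + B)"
      using IH omega_less_1 by (intro mult_left_mono) auto
    moreover have "(1 - \<omega>) * ((1 - \<omega>) ^ k * (L / 2 * R\<^sup>2) + B) + \<omega> * B =
        (1 - \<omega>) ^ Suc k * (L / 2 * R\<^sup>2) + B"
      by (simp add: algebra_simps add_divide_distrib diff_divide_distrib)
    ultimately have "F x' - F z + \<nu> / 2 * (norm (u' - z))\<^sup>2 \<le> (1 - \<omega>) ^ Suc k * (L / 2 * R\<^sup>2) + B"
      using step by linarith
    then show ?case using u' x' st' by (simp add: \<Phi>_def)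
  qed
  obtain u x where ux: "st k = (u, x)" by (cases "st k")
  have "F x - F z + \<nu> / 2 * (norm (u - z))\<^sup>2 \<le> (1 - \<omega>) ^ k * (L / 2 * R\<^sup>2) + B"
    using main[of k] ux by (simp add: \<Phi>_def)
  \<comment> \<open>Dropping the regularizer at \<open>x\<close> is free; its value at
    \<open>z\<close> is \<nu> R^2.\<close>
  moreover have "f x - f z \<le> F x - F z + \<nu> * R\<^sup>2"
    using L \<kappa> R by (simp add: F_def norm_minus_commute[of z])
  moreover have "0 \<le> \<nu> / 2 * (norm (u - z))\<^sup>2" using L \<kappa> by simp
  ultimately have "f x - f z \<le> (1 - \<omega>) ^ k * (L / 2 * R\<^sup>2) + 35 / 4 * (\<nu> * R\<^sup>2)"
    unfolding B_def by linarith
  then show ?thesis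
    using ux by (simp add: reagm_def st_def g_def)
qed

end

section \<open>Choice of the parameters and of the number of iterations\<close>

theorem theorem7p2:
  fixes L R \<alpha> \<beta> \<epsilon> :: real
  assumes "0 < \<epsilon>" and "\<epsilon> < L * R\<^sup>2"
    and "0 \<le> \<beta>" and "\<beta> \<le> 1 / 2"
    and "0 \<le> \<alpha>" and "\<alpha> \<le> 1 / 3 * (\<epsilon> / (12 * L * R\<^sup>2)) powr \<beta>"
  shows "\<exists>\<mu> L' \<mu>' a :: real.
    \<mu> > 0 \<and> L' \<ge> \<mu>' \<and> \<mu>' > 0 \<and> 0 \<le> a \<and> a \<le> 1 / 3 \<and>
    (\<forall>(n::nat) (f :: fseq \<Rightarrow> real) (G :: fseq \<Rightarrow> fseq) (Gt :: fseq \<Rightarrow> fseq) x0 xstar.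
       is_gradient_on G f (Rn n) \<longrightarrow>
       grad_convex_on (Rn n) f G \<longrightarrow>
       smooth_on L (Rn n) f G \<longrightarrow>
       xstar \<in> Rn n \<longrightarrow> (\<forall>x\<in>Rn n. f xstar \<le> f x) \<longrightarrow>
       x0 \<in> Rn n \<longrightarrow> norm (x0 - xstar) = R \<longrightarrow>
       (\<forall>x\<in>Rn n. Gt x \<in> Rn n) \<longrightarrow> relative_noise_on \<alpha> (Rn n) G Gt \<longrightarrow>
       (\<exists>N::nat.
          real N \<le> 150 * (12 * L * R\<^sup>2 / \<epsilon>) powr (1 - \<beta>) * ln (4 * L * R\<^sup>2 / \<epsilon>) + 1 \<and>
          f (reagm L' \<mu>' x0 a (regularized_estimate \<mu> x0 Gt) N) - f xstar \<le> \<epsilon>))"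
proof -
  define \<kappa> where "\<kappa> = 12 * L * R\<^sup>2 / \<epsilon>"
  define t where "t = \<kappa> powr - \<beta>"
  have LR: "0 < L * R\<^sup>2" using assms by linarith
  then have L: "0 < L" by (simp add: zero_less_mult_iff)
  have \<kappa>: "12 < \<kappa>" using assms by (simp add: \<kappa>_def field_simps)
  interpret reagm_parameters L \<kappa> \<beta> t
    by unfold_locales (use L \<kappa> assms t_def in auto)
  have "\<epsilon> / (12 * L * R\<^sup>2) = 1 / \<kappa>" by (simp add: \<kappa>_def)
  then have \<alpha>: "\<alpha> \<le> t / 3"
    using assms \<kappa> by (simp add: t_def powr_divide powr_minus_divide)
  \<comment> \<open>The regularization parameter 2 \<nu> is thus \<epsilon> / (6 R^2), so the floor
    35/4 \<nu> R^2 is 35/48 \<epsilon>.\<close>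
  have \<nu>R: "\<nu> * R\<^sup>2 = \<epsilon> / 12"
    using LR assms(1) by (auto simp: \<kappa>_def field_simps)
  define X where "X = 150 * \<kappa> powr (1 - \<beta>) * ln (4 * L * R\<^sup>2 / \<epsilon>)"
  \<comment> \<open>Rounding up costs the summand 1 in the bound on the number of
    iterations.\<close>
  define N where "N = nat \<lceil>X\<rceil>"
  have quot: "1 < 4 * L * R\<^sup>2 / \<epsilon>" using assms by (simp add: field_simps)
  then have lnpos: "0 < ln (4 * L * R\<^sup>2 / \<epsilon>)" by simp
  then have "0 \<le> X" by (simp add: X_def)
  then have N: "X \<le> real N" "real N \<le> X + 1" by (auto simp: N_def)
  have "\<kappa> powr (1 - \<beta>) = \<kappa> * t"
    using \<kappa> by (simp add: t_def powr_diff powr_minus_divide)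
  then have "ln (4 * L * R\<^sup>2 / \<epsilon>) = X * (1 / (150 * \<kappa> * t))"
    using \<kappa> t_bounds by (simp add: X_def)
  \<comment> \<open>The lower bound on \<omega> has 85 in place of 150, so the claimed number of
    iterations leaves room.\<close>
  also have "\<dots> \<le> real N * \<omega>"
  proof (rule mult_mono)
    have "1 / (150 * \<kappa> * t) \<le> 1 / (85 * \<kappa> * t)"
      using \<kappa> t_bounds by (simp add: field_simps)
    then show "1 / (150 * \<kappa> * t) \<le> \<omega>" using omega_bounds by linarith
  qed (use N \<kappa> t_bounds in auto)
  finally have ln_le: "ln (4 * L * R\<^sup>2 / \<epsilon>) \<le> real N * \<omega>" .
  have "(1 - \<omega>) ^ N \<le> exp (- \<omega>) ^ N"
    using omega_less_1 exp_ge_add_one_self[of "- \<omega>"] by (intro power_mono) auto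
  also have "\<dots> = exp (- (real N * \<omega>))" by (simp add: exp_of_nat_mult[symmetric])
  also have "\<dots> \<le> exp (- ln (4 * L * R\<^sup>2 / \<epsilon>))" using ln_le by simp
  also have "\<dots> = \<epsilon> / (4 * L * R\<^sup>2)" using quot by (simp add: exp_minus)
  finally have "(1 - \<omega>) ^ N * (L / 2 * R\<^sup>2) \<le> \<epsilon> / (4 * L * R\<^sup>2) * (L / 2 * R\<^sup>2)"
    using LR by (intro mult_right_mono) auto
  also have "\<dots> = \<epsilon> / 8" using LR by (auto simp: field_simps)
  finally have decay: "(1 - \<omega>) ^ N * (L / 2 * R\<^sup>2) \<le> \<epsilon> / 8" .
  show ?thesis
  proof (rule exI[of _ "2 * \<nu>"], rule exI[of _ L], rule exI[of _ "2 * \<nu>"], rule exI[of _ "t / 3"],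
      intro conjI allI impI exI[of _ N])
    fix n f G Gt x0 xstar
    assume "is_gradient_on G f (Rn n)" "grad_convex_on (Rn n) f G" "smooth_on L (Rn n) f G"
      "xstar \<in> Rn n" "\<forall>x\<in>Rn n. f xstar \<le> f x" "x0 \<in> Rn n" "norm (x0 - xstar) = R"
      "\<forall>x\<in>Rn n. Gt x \<in> Rn n" "relative_noise_on \<alpha> (Rn n) G Gt"
    then have "f (reagm L (2 * \<nu>) x0 (t / 3) (regularized_estimate (2 * \<nu>) x0 Gt) N) - f xstar \<le>
        (1 - \<omega>) ^ N * (L / 2 * R\<^sup>2) + 35 / 4 * (\<nu> * R\<^sup>2)"
      using \<alpha> assms(5) by (intro reagm_convergence[OF subspace_Rn]) (auto simp: is_gradient_on_def)
    \<comment> \<open>The two contributions add up to 1/8 + 35/48 = 41/48 of \<epsilon>.\<close>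
    then show "f (reagm L (2 * \<nu>) x0 (t / 3) (regularized_estimate (2 * \<nu>) x0 Gt) N) - f xstar \<le> \<epsilon>"
      using decay \<nu>R assms(1) by linarith
  next
    show "real N \<le> 150 * (12 * L * R\<^sup>2 / \<epsilon>) powr (1 - \<beta>) * ln (4 * L * R\<^sup>2 / \<epsilon>) + 1"
      using N by (simp add: X_def \<kappa>_def)
  qed (use L \<kappa> t_bounds in \<open>auto simp: field_simps\<close>)
qed

end
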